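(* Let $L:\Theta\to\mathbb{R}$, maps $T_1,\dots,T_k:\Theta\to\Theta$, a starting value $\theta_0\in\Theta$, and the sequence $(\theta_n)_{n\in\mathbb{N}}$ given by $\theta_{n+1}=T_k\cdots T_1(\theta_n)$, $n\ge0$, be as in the iterative partial maximization setting described in the context. Suppose that the likelihood equations $$\frac{\partial L(\theta)}{\partial\theta}=0,\qquad\theta\in\Theta,$$ have only finitely many solutions that lie on the same contour of $L$, i.e. for every $c\in\mathbb{R}$ there are only finitely many solutions $\theta\in\Theta$ with $L(\theta)=c$. Then the sequence $(\theta_n)_{n\in\mathbb{N}}$ converges to one solution $\theta^*$ of the likelihood equations.
   Context: Iterative partial maximization setting. $\Theta\subseteq\mathbb{R}^d$ is an open set and $L:\Theta\to\mathbb{R}$ is a differentiable function. The point $\theta_0\in\Theta$ is such that $\Theta_0=\{\theta\in\Theta\mid L(\theta)\ge L(\theta_0)\}$ is compact. For functions $g_i:\Theta\to\mathbb{R}^{d_i}$, $i=1,\dots,k$, and $\theta^*\in\Theta$, define the sections $$\Theta_i(\theta^* )=\{\theta\in\Theta\mid g_i(\theta)=g_i(\theta^* )\}.$$ Assume: (i) for all $\theta^*\in\Theta$ and $i=1,\dots,k$, the maximum of $L$ over $\Theta_i(\theta^* )$ is uniquely attained, and the associated map $T_i:\Theta\to\Theta$, $T_i(\theta^* )=\mathop{\mathrm{argmax}}_{\theta\in\Theta_i(\theta^* )}L(\theta)$, is continuous for every $i=1,\dots,k$; (ii) if $\theta^*\in\Theta$ maximizes $L$ over all sections $\Theta_i(\theta^*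 )$, $i=1,\dots,k$ (equivalently $\theta^*=T_i(\theta^* )$ for all $i$), then $\theta^*$ solves the likelihood equations $\frac{\partial L(\theta)}{\partial\theta}\big|_{\theta=\theta^*}=0$. The sequence is defined by $\theta_{n+1}=T_k\cdots T_1(\theta_n)$ (composition of maps) for $n\ge0$, starting at $\theta_0$. *)

theory Defs
  imports "HOL-Analysis.Analysis"
begin

definition g_section :: "'a set \<Rightarrow> ('a \<Rightarrow> 'b) \<Rightarrow> 'a \<Rightarrow> 'a set" where
  "g_section \<Theta> g \<theta>s = {\<theta> \<in> \<Theta>. g \<theta> = g \<theta>s}"

text \<open>\<^const>\<open>arg_max\<close> is a choice operator, so the following map is determined only where
  the maximizer exists and is unique.\<close>

definition partial_max :: "'a set \<Rightarrow> ('a \<Rightarrow> real) \<Rightarrow> ('a \<Rightarrow> 'b) \<Rightarrow> 'a \<Rightarrow> 'a" where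
  "partial_max \<Theta> L g \<theta>s = arg_max L (\<lambda>\<theta>. \<theta> \<in> g_section \<Theta> g \<theta>s)"

definition likelihood_solution ::
  "(real ^ 'd) set \<Rightarrow> (real ^ 'd \<Rightarrow> real) \<Rightarrow> real ^ 'd \<Rightarrow> bool" where
  "likelihood_solution \<Theta> L \<theta> \<longleftrightarrow> \<theta> \<in> \<Theta> \<and> (L has_derivative (\<lambda>_. 0)) (at \<theta>)"

end

theory Submission
  imports Defs
begin

text \<open>
  One sweep \<open>S = T\<^sub>k \<circ> \<dots> \<circ> T\<^sub>1\<close> is continuous on \<open>\<Theta>\<close> and never decreases \<open>L\<close>, since each point
  belongs to its own sections. Because maximizers are unique, a partial maximization that moves a
  point strictly increases \<open>L\<close>; so \<open>L (S x) = L x\<close> forces every \<open>T\<^sub>i\<close> to fix \<open>x\<close>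
  (\<open>fold_strict_increase\<close>), and \<open>x\<close> then solves the likelihood equations. The orbit stays in the
  compact superlevel set of \<open>\<theta>\<^sub>0\<close>, where \<open>L\<close> along it increases to a finite limit \<open>c\<close>. If a
  subsequence tends to \<open>x\<close>, the subsequence shifted by one tends to \<open>S x\<close>, whence
  \<open>L x = c = L (S x)\<close> (\<open>subseq_limit_invariant\<close>). Every subsequential limit is therefore a fixed
  point of \<open>S\<close> and a solution on the contour \<open>L = c\<close>, and there are only finitely many of these.

  It remains to exclude that the orbit keeps wandering between several of these points
  (\<open>orbit_converges_finite_fixpoints\<close>). By compactness it eventually stays close to the finite set of
  solutions on the contour. As \<open>S\<close> moves points near a fixed point only a little, the orbit can no
  longer jump from the vicinity of one of them to that of another.
\<close>

text \<open>Otherwise the terms outside \<open>U\<close> would have a limit point, which would lie in the closed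
  complement of \<open>U\<close>.\<close>

lemma eventually_in_nbhd_of_limits:
  fixes X :: "nat \<Rightarrow> 'a::metric_space"
  assumes "compact K" "\<And>n. X n \<in> K" "open U"
    and lim: "\<And>r l. strict_mono r \<Longrightarrow> (X \<circ> r) \<longlonglongrightarrow> l \<Longrightarrow> l \<in> U"
  shows "eventually (\<lambda>n. X n \<in> U) sequentially"
proof (rule ccontr)
  assume "\<not> eventually (\<lambda>n. X n \<in> U) sequentially"
  then have "infinite {n. X n \<notin> U}"
    by (simp add: eventually_cofinite flip: cofinite_eq_sequentially)
  then obtain r :: "nat \<Rightarrow> nat" where r: "strict_mono r" "\<And>n. X (r n) \<notin> U"
    using infinite_enumerate by blast
  obtain l q where q: "strict_mono q" "((X \<circ> r) \<circ> q) \<longlonglongrightarrow> l"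
    using \<open>compact K\<close> assms(2) unfolding compact_def by (metis comp_apply)
  have "l \<in> U"
    using lim[of "r \<circ> q" l] q r(1) by (simp add: strict_mono_o o_assoc)
  moreover have "l \<in> - U"
    by (rule closed_sequentially[of _ "(X \<circ> r) \<circ> q"]) (use \<open>open U\<close> r q in auto)
  ultimately show False by simp
qed

text \<open>Pick a subsequential limit \<open>x\<close> and a ball around it containing no other point of \<open>F\<close>. The
  orbit is eventually either very close to \<open>x\<close> or outside this ball; from very close to \<open>x\<close> a single
  step cannot leave the ball, so once the orbit is very close to \<open>x\<close> it remains so.\<close>

lemma orbit_converges_finite_fixpoints:
  fixes X :: "nat \<Rightarrow> 'a::metric_space"
  assumes K: "compact K" "\<And>n. X n \<in> K"
    and S: "continuous_on K S" "\<And>n. X (Suc n) = S (X n)"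
    and F: "finite F"
    and lim: "\<And>r l. strict_mono r \<Longrightarrow> (X \<circ> r) \<longlonglongrightarrow> l \<Longrightarrow> l \<in> F \<and> S l = l"
  shows "\<exists>l\<in>F. X \<longlonglongrightarrow> l"
proof -
  obtain x q where x: "x \<in> K" and q: "strict_mono q" "(X \<circ> q) \<longlonglongrightarrow> x"
    using K unfolding compact_def by metis
  have xF: "x \<in> F" and Sx: "S x = x" using lim[OF q] by auto
  obtain e0 where e0: "e0 > 0" "\<And>y. y \<in> F \<Longrightarrow> y \<noteq> x \<Longrightarrow> e0 \<le> dist x y"
    using finite_set_avoid[OF F, of x] by blast
  have "X \<longlonglongrightarrow> x"
  proof (rule metric_LIMSEQ_I)
    fix r :: real assume "r > 0"
    \<comment> \<open>Halving \<open>e0\<close> keeps the other points of \<open>F\<close> outside even the closed ball of radius \<open>e\<close>.\<close>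
    define e where "e = min r (e0 / 2)"
    have e: "e > 0" "e \<le> r" "e < e0" using \<open>r > 0\<close> e0(1) by (auto simp: e_def)
    obtain d0 where d0: "d0 > 0" "\<And>y. y \<in> K \<Longrightarrow> dist y x < d0 \<Longrightarrow> dist (S y) (S x) < e"
      using S(1) x e(1) unfolding continuous_on_iff by metis
    define d where "d = min d0 e"
    have d: "d > 0" "d \<le> d0" "d \<le> e" using d0(1) e(1) by (auto simp: d_def)
    have "eventually (\<lambda>n. X n \<in> ball x d \<union> - cball x e) sequentially"
    proof (rule eventually_in_nbhd_of_limits[OF K])
      show "open (ball x d \<union> - cball x e)" by auto
      fix p l assume "strict_mono p" "(X \<circ> p) \<longlonglongrightarrow> l"
      then have "l \<in> F" using lim by blast
      then show "l \<in> ball x d \<union> - cball x e"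
        using e0(2)[of l] d e by (cases "l = x") auto
    qed
    then obtain N where N: "\<And>n. n \<ge> N \<Longrightarrow> X n \<in> ball x d \<union> - cball x e"
      by (auto simp: eventually_sequentially)
    have "eventually (\<lambda>n. dist ((X \<circ> q) n) x < d) sequentially"
      using q(2) d(1) by (rule tendstoD)
    then obtain M where M: "\<And>n. n \<ge> M \<Longrightarrow> dist (X (q n)) x < d"
      by (auto simp: eventually_sequentially)
    define n0 where "n0 = q (max M N)"
    have n0: "n0 \<ge> N" "dist (X n0) x < d"
      using seq_suble[OF q(1), of "max M N"] M[of "max M N"] by (auto simp: n0_def)
    have "dist (X n) x < d" if "n \<ge> n0" for n
      using that
    proof (induction n rule: dec_induct)
      case base
      show ?case by (rule n0)
    next
      case (step n)
      have "dist (X (Suc n)) x < e"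
        using d0(2)[OF K(2), of n] step d Sx S(2) by simp
      then show ?case
        using N[of "Suc n"] step n0 by (auto simp: dist_commute)
    qed
    then show "\<exists>no. \<forall>n\<ge>no. dist (X n) x < r" using d e by force
  qed
  with xF show ?thesis by blast
qed

text \<open>The values of \<open>L\<close> along the orbit converge, and both \<open>l\<close> and \<open>S l\<close> are limits of
  subsequences of the orbit, so \<open>L\<close> takes the same value at both.\<close>

lemma subseq_limit_invariant:
  fixes X :: "nat \<Rightarrow> 'a::metric_space" and L :: "'a \<Rightarrow> real"
  assumes K: "compact K" "\<And>n. X n \<in> K"
    and S: "continuous_on K S" "\<And>n. X (Suc n) = S (X n)"
    and L: "continuous_on K L"
    and conv: "(\<lambda>n. L (X n)) \<longlonglongrightarrow> c"
    and r: "strict_mono r" "(X \<circ> r) \<longlonglongrightarrow> l"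
  shows "l \<in> K \<and> L l = c \<and> L (S l) = c"
proof -
  have lK: "l \<in> K"
    using closed_sequentially[OF compact_imp_closed[OF K(1)] _ r(2)] K(2) by simp
  have S_lim: "(\<lambda>n. X (Suc (r n))) \<longlonglongrightarrow> S l"
    using continuous_on_tendsto_compose[OF S(1) r(2) lK] K(2) S(2) by simp
  have SlK: "S l \<in> K"
    using closed_sequentially[OF compact_imp_closed[OF K(1)] _ S_lim] K(2) by simp
  have "(\<lambda>n. L (X (r n))) \<longlonglongrightarrow> L l"
    using continuous_on_tendsto_compose[OF L r(2) lK] K(2) by simp
  moreover have "(\<lambda>n. L (X (r n))) \<longlonglongrightarrow> c"
    using LIMSEQ_subseq_LIMSEQ[OF conv r(1)] by (simp add: o_def)
  moreover have "(\<lambda>n. L (X (Suc (r n)))) \<longlonglongrightarrow> L (S l)"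
    using continuous_on_tendsto_compose[OF L S_lim SlK] K(2) by simp
  moreover have "(\<lambda>n. L (X (Suc (r n)))) \<longlonglongrightarrow> c"
    using LIMSEQ_subseq_LIMSEQ[OF conv, of "\<lambda>n. Suc (r n)"] r(1)
    by (simp add: o_def strict_mono_def)
  ultimately show ?thesis using lK LIMSEQ_unique by blast
qed

lemma fold_closed_continuous:
  assumes "\<And>i. i \<in> set xs \<Longrightarrow> f i ` A \<subseteq> A" "\<And>i. i \<in> set xs \<Longrightarrow> continuous_on A (f i)"
  shows "fold f xs ` A \<subseteq> A \<and> continuous_on A (fold f xs)"
  using assms
proof (induction xs)
  case Nil
  show ?case by (simp add: id_def)
next
  case (Cons i xs)
  then have IH: "fold f xs ` A \<subseteq> A" "continuous_on A (fold f xs)"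
    and i: "f i ` A \<subseteq> A" "continuous_on A (f i)" by auto
  have "continuous_on A (fold f xs \<circ> f i)"
    by (intro continuous_on_compose i(2) continuous_on_subset[OF IH(2) i(1)])
  then show ?case using IH(1) i(1) by fastforce
qed

text \<open>No map in the list can undo an increase made by an earlier one: if the total increase
  vanishes, the first map fixes \<open>x\<close>, so the second one also acts on \<open>x\<close> itself, and so on.\<close>

lemma fold_strict_increase:
  fixes L :: "'a \<Rightarrow> 'b::linorder"
  assumes "\<And>i y. i \<in> set xs \<Longrightarrow> y \<in> A \<Longrightarrow> f i y \<in> A"
    and "\<And>i y. i \<in> set xs \<Longrightarrow> y \<in> A \<Longrightarrow> f i y \<noteq> y \<Longrightarrow> L y < L (f i y)"
    and "x \<in> A"
  shows "L x \<le> L (fold f xs x) \<and> (L (fold f xs x) = L x \<longrightarrow> (\<forall>i\<in>set xs. f i x = x))"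
  using assms
proof (induction xs arbitrary: x)
  case Nil
  show ?case by simp
next
  case (Cons i xs)
  have "f i x \<in> A" using Cons.prems by simp
  then have IH: "L (f i x) \<le> L (fold f xs (f i x))"
    "L (fold f xs (f i x)) = L (f i x) \<longrightarrow> (\<forall>j\<in>set xs. f j (f i x) = f i x)"
    using Cons.IH[of "f i x"] Cons.prems by auto
  show ?case
  proof (cases "f i x = x")
    case True
    with IH show ?thesis by simp
  next
    case False
    then have "L x < L (f i x)" using Cons.prems by simp
    with IH(1) show ?thesis by auto
  qed
qed

lemma is_arg_max_partial_max:
  assumes "\<exists>!\<xi>. is_arg_max L (\<lambda>\<xi>. \<xi> \<in> g_section \<Theta> g x) \<xi>"
  shows "is_arg_max L (\<lambda>\<xi>. \<xi> \<in> g_section \<Theta> g x) (partial_max \<Theta> L g x)"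
  unfolding partial_max_def arg_max_def using assms by (metis someI_ex)

lemma partial_max_mem:
  assumes "\<exists>!\<xi>. is_arg_max L (\<lambda>\<xi>. \<xi> \<in> g_section \<Theta> g x) \<xi>"
  shows "partial_max \<Theta> L g x \<in> \<Theta>"
  using is_arg_max_partial_max[OF assms] by (simp add: is_arg_max_def g_section_def)

text \<open>A point with the same value of \<open>L\<close> as the maximizer of its section would be a maximizer as
  well, so uniqueness makes the increase strict.\<close>

lemma partial_max_strict_increase:
  assumes uniq: "\<exists>!\<xi>. is_arg_max L (\<lambda>\<xi>. \<xi> \<in> g_section \<Theta> g x) \<xi>"
    and "x \<in> \<Theta>" "partial_max \<Theta> L g x \<noteq> x"
  shows "L x < L (partial_max \<Theta> L g x)"
proof (rule ccontr)
  assume "\<not> L x < L (partial_max \<Theta> L g x)"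
  then have "is_arg_max L (\<lambda>\<xi>. \<xi> \<in> g_section \<Theta> g x) x"
    using is_arg_max_partial_max[OF uniq] \<open>x \<in> \<Theta>\<close>
    by (auto simp: is_arg_max_def g_section_def not_less dest: order_trans)
  then show False using uniq is_arg_max_partial_max[OF uniq] assms(3) by blast
qed

theorem corollary2:
  fixes \<Theta> :: "(real ^ 'd) set"
    and L :: "real ^ 'd \<Rightarrow> real"
    and k :: nat
    and dm :: "nat \<Rightarrow> nat"
    and g :: "nat \<Rightarrow> real ^ 'd \<Rightarrow> (nat \<Rightarrow> real)"
    and T :: "nat \<Rightarrow> real ^ 'd \<Rightarrow> real ^ 'd"
    and \<theta>0 :: "real ^ 'd"
    and \<theta> :: "nat \<Rightarrow> real ^ 'd"
  assumes "open \<Theta>"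
    and "L differentiable_on \<Theta>"
    and "\<theta>0 \<in> \<Theta>"
    and "compact {\<xi> \<in> \<Theta>. L \<xi> \<ge> L \<theta>0}"
    and "\<forall>i\<in>{1..k}. g i \<in> \<Theta> \<rightarrow> ({..<dm i} \<rightarrow>\<^sub>E (UNIV :: real set))"
    and "\<forall>\<theta>s\<in>\<Theta>. \<forall>i\<in>{1..k}. \<exists>!\<xi>. is_arg_max L (\<lambda>\<xi>. \<xi> \<in> g_section \<Theta> (g i) \<theta>s) \<xi>"
    and "\<forall>i\<in>{1..k}. \<forall>\<theta>s\<in>\<Theta>. T i \<theta>s = partial_max \<Theta> L (g i) \<theta>s"
    and "\<forall>i\<in>{1..k}. continuous_on \<Theta> (T i)"
    and "\<forall>\<theta>s\<in>\<Theta>. (\<forall>i\<in>{1..k}. is_arg_max L (\<lambda>\<xi>. \<xi> \<in> g_section \<Theta> (g i) \<theta>s) \<theta>s)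
           \<longrightarrow> likelihood_solution \<Theta> L \<theta>s"
    and "\<theta> 0 = \<theta>0"
    and "\<forall>n. \<theta> (Suc n) = fold T [1..<Suc k] (\<theta> n)"
    and "\<forall>c. finite {\<xi>. likelihood_solution \<Theta> L \<xi> \<and> L \<xi> = c}"
  shows "\<exists>\<theta>s. likelihood_solution \<Theta> L \<theta>s \<and> \<theta> \<longlonglongrightarrow> \<theta>s"
proof -
  define K where "K = {\<xi> \<in> \<Theta>. L \<xi> \<ge> L \<theta>0}"
  define S where "S = fold T [1..<Suc k]"
  have idx: "set [1..<Suc k] = {1..k}" by auto
  have T_mem: "T i x \<in> \<Theta>" if "i \<in> {1..k}" "x \<in> \<Theta>" for i x
    using that partial_max_mem assms(6,7) by metis
  have T_inc: "L x < L (T i x)" if "i \<in> {1..k}" "x \<in> \<Theta>" "T i x \<noteq> x" for i x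
    using that partial_max_strict_increase assms(6,7) by metis
  have S_mem: "S ` \<Theta> \<subseteq> \<Theta>" and S_cont: "continuous_on \<Theta> S"
    using fold_closed_continuous[of "[1..<Suc k]" T \<Theta>] T_mem assms(8)
    unfolding S_def idx by blast+
  have S_inc: "L x \<le> L (S x)"
    and S_eq: "L (S x) = L x \<Longrightarrow> \<forall>i\<in>{1..k}. T i x = x" if "x \<in> \<Theta>" for x
    using fold_strict_increase[of "[1..<Suc k]" \<Theta> T L x] T_mem T_inc that
    unfolding S_def idx by blast+
  have S_fix: "S x = x" if "\<forall>i\<in>{1..k}. T i x = x" for x
    unfolding S_def using that
    by (intro fold_invariant[where P = "\<lambda>y. y = x" and Q = "\<lambda>i. i \<in> {1..k}"]) auto
  have step: "\<theta> (Suc n) = S (\<theta> n)" for n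
    using assms(11) by (simp add: S_def)
  have orbit: "\<theta> n \<in> K" for n
  proof (induction n)
    case 0
    show ?case using assms(3,10) by (simp add: K_def)
  next
    case (Suc n)
    then show ?case using S_mem S_inc[of "\<theta> n"] step by (auto simp: K_def)
  qed
  have compact_K: "compact K" using assms(4) by (simp add: K_def)
  have "K \<subseteq> \<Theta>" by (auto simp: K_def)
  then have S_cont_K: "continuous_on K S" using S_cont continuous_on_subset by blast
  have L_cont: "continuous_on K L"
    using differentiable_imp_continuous_on[OF assms(2)] \<open>K \<subseteq> \<Theta>\<close> continuous_on_subset by blast
  have "incseq (\<lambda>n. L (\<theta> n))"
    using S_inc orbit \<open>K \<subseteq> \<Theta>\<close> by (intro incseq_SucI) (auto simp: step)
  moreover have "bdd_above (range (\<lambda>n. L (\<theta> n)))"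
    using compact_imp_bounded[OF compact_continuous_image[OF L_cont compact_K]] orbit
    by (intro bdd_above_mono[OF bounded_imp_bdd_above]) auto
  ultimately obtain c where c: "(\<lambda>n. L (\<theta> n)) \<longlonglongrightarrow> c"
    using LIMSEQ_incseq_SUP by blast
  define F where "F = {\<xi>. likelihood_solution \<Theta> L \<xi> \<and> L \<xi> = c}"
  have "\<exists>l\<in>F. \<theta> \<longlonglongrightarrow> l"
  proof (rule orbit_converges_finite_fixpoints[where X = \<theta> and S = S, OF compact_K orbit S_cont_K step])
    show "finite F" using assms(12) by (simp add: F_def)
    fix r l assume "strict_mono r" "(\<theta> \<circ> r) \<longlonglongrightarrow> l"
    then have l: "l \<in> K" "L l = c" "L (S l) = c"
      using subseq_limit_invariant[where X = \<theta> and S = S, OF compact_K orbit S_cont_K step L_cont c] by blast+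
    then have "l \<in> \<Theta>" using \<open>K \<subseteq> \<Theta>\<close> by blast
    have fixed: "\<forall>i\<in>{1..k}. T i l = l" using S_eq[OF \<open>l \<in> \<Theta>\<close>] l by simp
    have "\<forall>i\<in>{1..k}. is_arg_max L (\<lambda>\<xi>. \<xi> \<in> g_section \<Theta> (g i) l) l"
      using fixed is_arg_max_partial_max assms(6,7) \<open>l \<in> \<Theta>\<close> by metis
    then have "likelihood_solution \<Theta> L l" using assms(9) \<open>l \<in> \<Theta>\<close> by blast
    then show "l \<in> F \<and> S l = l" using l S_fix[OF fixed] by (simp add: F_def)
  qed
  then show ?thesis by (auto simp: F_def)
qed

end
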